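(* The Gaussian and mean curvatures of an admissible pseudo-isotropic helicoidal surface of ni-type in $\mathbb{I}^3_{\mathrm{p}}$, $$Yh_2(u,t)=(x(u)\cosh(t\phi)+y(u)\sinh(t\phi),\ x(u)\sinh(t\phi)+y(u)\cosh(t\phi),\ ct),$$ with $C^2$ generating curve $\alpha(u)=(x(u),y(u),0)$, are respectively $$K=\frac{c^2}{\phi^2}\,\frac{(x'^2-y'^2)^2-(xy'-x'y)(x''y'-x'y'')}{(xx'-yy')^4}$$ and $$H=\frac{c}{\phi}\,\frac{(x^2-y^2)(x''y'-x'y'')+(x'^2-y'^2)(xy'-x'y)}{2(xx'-yy')^3}.$$
   Context: Here $c,\phi\in\mathbb{R}$ are constants, and primes denote $d/du$. The pseudo-isotropic space $\mathbb{I}^3_{\mathrm{p}}$ is $\mathbb{R}^3$ with the degenerate metric $\langle u,v\rangle_{pz}=u^1v^1-u^2v^2$. For a $C^2$ parameterized surface $\mathbf{x}(u^1,u^2)=(x^1,x^2,x^3)$ write $\mathbf{x}_i=\partial\mathbf{x}/\partial u^i$, $\mathbf{x}_{ij}=\partial^2\mathbf{x}/\partial u^i\partial u^j$, $x^i_k=\partial x^i/\partial u^k$, $X_{ij}=x^i_1x^j_2-x^j_1x^i_2$. The surface is admissible if $X_{12}\neq0$ (equivalently, the induced metric has rank 2). Put $g_{ij}=\langle\mathbf{x}_i,\mathbf{x}_j\rangle_{pz}$, $N_h=\left(\frac{X_{23}}{X_{12}},\frac{X_{13}}{X_{12}},1\right)$, $h_{ij}=\langle N_h,\mathbf{x}_{ij}\rangle_1$,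 where $\langle u,v\rangle_1=u^1v^1-u^2v^2+u^3v^3$. The Gaussian and mean curvatures are $$K=\frac{h_{11}h_{22}-h_{12}^2}{g_{11}g_{22}-g_{12}^2},\qquad H=\frac12\,\frac{g_{11}h_{22}-2g_{12}h_{12}+g_{22}h_{11}}{g_{11}g_{22}-g_{12}^2};$$ equivalently $K=\det L$, $H=\frac12\mathrm{tr}\,L$ with $L=-D\xi^{\mathrm p}$, $\xi^{\mathrm p}=\left(A,B,\frac12(1-A^2+B^2)\right)$, $A=X_{23}/X_{12}$, $B=X_{13}/X_{12}$. For the surface in the claim the coordinates are $(u^1,u^2)=(u,t)$. *)

theory Defs
  imports "HOL-Analysis.Analysis"
begin

text \<open>Pseudo-isotropic 3-space is \<^typ>\<open>real^3\<close> with the degenerate metric \<open>inner_pz\<close>;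
  \<open>inner_1\<close> is the auxiliary nondegenerate metric used for the second fundamental form.\<close>

definition inner_pz :: "real^3 \<Rightarrow> real^3 \<Rightarrow> real" where
  "inner_pz v w = v$1 * w$1 - v$2 * w$2"

definition inner_1 :: "real^3 \<Rightarrow> real^3 \<Rightarrow> real" where
  "inner_1 v w = v$1 * w$1 - v$2 * w$2 + v$3 * w$3"

definition C2_curve_on :: "real set \<Rightarrow> (real \<Rightarrow> 'a::real_normed_vector) \<Rightarrow> bool" where
  "C2_curve_on I \<alpha> \<longleftrightarrow>
     \<alpha> C1_differentiable_on I \<and> (\<lambda>s. vector_derivative \<alpha> (at s)) C1_differentiable_on I"

text \<open>A parameterized surface is a map \<open>S\<close> from \<^typ>\<open>real^2\<close>, with parameters \<open>p$1\<close>, \<open>p$2\<close>.\<close>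

definition partial :: "2 \<Rightarrow> (real^2 \<Rightarrow> 'a::real_normed_vector) \<Rightarrow> real^2 \<Rightarrow> 'a" where
  "partial i S p = vector_derivative (\<lambda>s. S (p + s *\<^sub>R axis i 1)) (at 0)"

definition tangent_minor :: "(real^2 \<Rightarrow> real^3) \<Rightarrow> 3 \<Rightarrow> 3 \<Rightarrow> real^2 \<Rightarrow> real" where
  "tangent_minor S i j p =
     partial 1 S p $ i * partial 2 S p $ j - partial 1 S p $ j * partial 2 S p $ i"

definition admissible_on :: "(real^2) set \<Rightarrow> (real^2 \<Rightarrow> real^3) \<Rightarrow> bool" where
  "admissible_on U S \<longleftrightarrow> (\<forall>p\<in>U. tangent_minor S 1 2 p \<noteq> 0)"

definition first_form :: "(real^2 \<Rightarrow> real^3) \<Rightarrow> 2 \<Rightarrow> 2 \<Rightarrow> real^2 \<Rightarrow> real" where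
  "first_form S i j p = inner_pz (partial i S p) (partial j S p)"

text \<open>The plus sign in the second component is due to the signature: with it, \<open>normal_h S p\<close> is
  \<open>inner_1\<close>-orthogonal to both tangent vectors.\<close>

definition normal_h :: "(real^2 \<Rightarrow> real^3) \<Rightarrow> real^2 \<Rightarrow> real^3" where
  "normal_h S p = vector [tangent_minor S 2 3 p / tangent_minor S 1 2 p,
                          tangent_minor S 1 3 p / tangent_minor S 1 2 p, 1]"

definition second_form :: "(real^2 \<Rightarrow> real^3) \<Rightarrow> 2 \<Rightarrow> 2 \<Rightarrow> real^2 \<Rightarrow> real" where
  "second_form S i j p = inner_1 (normal_h S p) (partial i (partial j S) p)"

definition gaussian_curvature :: "(real^2 \<Rightarrow> real^3) \<Rightarrow> real^2 \<Rightarrow> real" where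
  "gaussian_curvature S p =
     (second_form S 1 1 p * second_form S 2 2 p - (second_form S 1 2 p)\<^sup>2)
     / (first_form S 1 1 p * first_form S 2 2 p - (first_form S 1 2 p)\<^sup>2)"

definition mean_curvature :: "(real^2 \<Rightarrow> real^3) \<Rightarrow> real^2 \<Rightarrow> real" where
  "mean_curvature S p =
     1/2 * ((first_form S 1 1 p * second_form S 2 2 p
             - 2 * first_form S 1 2 p * second_form S 1 2 p
             + first_form S 2 2 p * second_form S 1 1 p)
            / (first_form S 1 1 p * first_form S 2 2 p - (first_form S 1 2 p)\<^sup>2))"

text \<open>Helicoidal surfaces of ni-type are swept out by a curve in the (non-isotropic) plane of the
  first two coordinates under a hyperbolic rotation by \<open>t * \<phi>\<close> in that plane combined with the
  translation \<open>c * t\<close> along the isotropic direction.\<close>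

definition generating_curve :: "(real \<Rightarrow> real) \<Rightarrow> (real \<Rightarrow> real) \<Rightarrow> real \<Rightarrow> real^3" where
  "generating_curve x y u = vector [x u, y u, 0]"

definition helicoidal_ni ::
  "real \<Rightarrow> real \<Rightarrow> (real \<Rightarrow> real) \<Rightarrow> (real \<Rightarrow> real) \<Rightarrow> real^2 \<Rightarrow> real^3" where
  "helicoidal_ni c \<phi> x y p =
     (let u = p$1; t = p$2 in
      vector [x u * cosh (t * \<phi>) + y u * sinh (t * \<phi>),
              x u * sinh (t * \<phi>) + y u * cosh (t * \<phi>),
              c * t])"

end

theory Submission
  imports Defs
begin

text \<open>
  The surface is an orbit of the planar curve \<open>\<alpha>\<close> under a one-parameter group: at time \<open>t\<close> the
  point \<open>\<alpha> u\<close> is moved by the hyperbolic rotation (\<open>boost\<close>) with angle \<open>t * \<phi>\<close> and lifted by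
  \<open>c * t\<close> along the isotropic axis. Differentiating a boost in its angle again yields a boost, that
  of the vector with its first two components exchanged. Hence every first and second partial
  derivative of the surface at \<open>(u, t)\<close> is the boost with angle \<open>t * \<phi>\<close> of a vector that no longer
  depends on \<open>t\<close>:
  \<open>(x', y', 0)\<close> and \<open>(\<phi> y, \<phi> x, c)\<close> for the tangent vectors, and \<open>(x'', y'', 0)\<close>,
  \<open>(\<phi> y', \<phi> x', 0)\<close>, \<open>(\<phi>\<^sup>2 x, \<phi>\<^sup>2 y, 0)\<close> for the second derivatives.

  Boosts preserve both bilinear forms and the minor \<open>X\<^sub>1\<^sub>2\<close>, and they carry the auxiliary normal
  along with the tangent vectors. The fundamental forms therefore have the values that these
  vectors give at \<open>t = 0\<close>. In terms of \<open>D = x x' - y y'\<close>, \<open>W = x y' - x' y\<close>, \<open>a = x'\<^sup>2 - y'\<^sup>2\<close> and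
  \<open>Q = x'' y' - x' y''\<close> they are
  \<open>g\<^sub>1\<^sub>1 = a\<close>, \<open>g\<^sub>1\<^sub>2 = -\<phi> W\<close>, \<open>g\<^sub>2\<^sub>2 = -\<phi>\<^sup>2 (x\<^sup>2 - y\<^sup>2)\<close> and
  \<open>h\<^sub>1\<^sub>1 = c Q / (\<phi> D)\<close>, \<open>h\<^sub>1\<^sub>2 = -c a / D\<close>, \<open>h\<^sub>2\<^sub>2 = c \<phi> W / D\<close>.
  Lagrange's identity for the Lorentzian plane gives \<open>det g = -X\<^sub>1\<^sub>2\<^sup>2 = -\<phi>\<^sup>2 D\<^sup>2\<close>, which
  admissibility keeps away from zero, and substitution gives both curvatures.
\<close>

section \<open>Hyperbolic rotations of the top plane\<close>

definition boost :: "real \<Rightarrow> real^3 \<Rightarrow> real^3" where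
  "boost \<theta> v = vector [v$1 * cosh \<theta> + v$2 * sinh \<theta>, v$1 * sinh \<theta> + v$2 * cosh \<theta>, v$3]"

lemma boost_nth [simp]:
  "boost \<theta> v $ 1 = v$1 * cosh \<theta> + v$2 * sinh \<theta>"
  "boost \<theta> v $ 2 = v$1 * sinh \<theta> + v$2 * cosh \<theta>"
  "boost \<theta> v $ 3 = v$3"
  by (simp_all add: boost_def)

text \<open>The Lorentzian counterpart of the invariance of the inner product under rotations: all
  invariances below come down to \<open>cosh\<^sup>2 - sinh\<^sup>2 = 1\<close>.\<close>

lemma inner_pz_boost: "inner_pz (boost \<theta> v) (boost \<theta> w) = inner_pz v w"
proof -
  have "inner_pz (boost \<theta> v) (boost \<theta> w) = inner_pz v w * ((cosh \<theta>)\<^sup>2 - (sinh \<theta>)\<^sup>2)"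
    by (simp add: inner_pz_def algebra_simps power2_eq_square)
  then show ?thesis by (simp add: hyperbolic_pythagoras)
qed

lemma inner_1_boost: "inner_1 (boost \<theta> v) (boost \<theta> w) = inner_1 v w"
proof -
  have "inner_1 a b = inner_pz a b + a$3 * b$3" for a b
    by (simp add: inner_1_def inner_pz_def)
  then show ?thesis by (simp add: inner_pz_boost)
qed

lemma minor_boost:
  "boost \<theta> v $ 1 * boost \<theta> w $ 2 - boost \<theta> v $ 2 * boost \<theta> w $ 1 = v$1 * w$2 - v$2 * w$1"
proof -
  have "boost \<theta> v $ 1 * boost \<theta> w $ 2 - boost \<theta> v $ 2 * boost \<theta> w $ 1
        = (v$1 * w$2 - v$2 * w$1) * ((cosh \<theta>)\<^sup>2 - (sinh \<theta>)\<^sup>2)"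
    by (simp add: algebra_simps power2_eq_square)
  then show ?thesis by (simp add: hyperbolic_pythagoras)
qed

section \<open>Derivatives of space curves and partial derivatives\<close>

lemma has_vector_derivative_vector3:
  assumes "(f has_real_derivative f') (at s)" "(g has_real_derivative g') (at s)"
    "(h has_real_derivative h') (at s)"
  shows "((\<lambda>s. vector [f s, g s, h s] :: real^3) has_vector_derivative vector [f', g', h']) (at s)"
proof -
  have vec: "vector [a, b, d] = a *\<^sub>R axis 1 1 + b *\<^sub>R axis 2 1 + d *\<^sub>R (axis 3 1 :: real^3)"
    for a b d :: real
    by (simp add: vec_eq_iff forall_3 axis_def)
  show ?thesis
    unfolding vec using assms
    by (auto intro!: derivative_eq_intros
        simp: has_real_derivative_iff_has_vector_derivative)
qed

lemma has_vector_derivative_nth: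
  assumes "(f has_vector_derivative f') (at s)"
  shows "((\<lambda>s. f s $ i) has_real_derivative f' $ i) (at s)"
  using bounded_linear.has_vector_derivative[OF bounded_linear_vec_nth assms]
  by (simp add: has_real_derivative_iff_has_vector_derivative)

lemma partial_eq:
  "partial 1 F (vector [u, t]) = vector_derivative (\<lambda>s. F (vector [s, t])) (at u)" (is ?first)
  "partial 2 F (vector [u, t]) = vector_derivative (\<lambda>s. F (vector [u, s])) (at t)" (is ?second)
proof -
  \<comment> \<open>Translating the parameter does not change a vector derivative, whether or not it exists.\<close>
  have shift: "vector_derivative (\<lambda>s. G (a + s)) (at 0) = vector_derivative G (at a)"
    for G :: "real \<Rightarrow> 'a" and a :: real
  proof -
    have "((\<lambda>s. G (a + s)) has_vector_derivative D) (at 0)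
          \<longleftrightarrow> (G has_vector_derivative D) (at a)" for D
    proof
      assume "((\<lambda>s. G (a + s)) has_vector_derivative D) (at 0)"
      moreover have "((\<lambda>s. s - a) has_vector_derivative 1) (at a)"
        by (auto intro!: derivative_eq_intros)
      ultimately show "(G has_vector_derivative D) (at a)"
        using vector_diff_chain_at[of "\<lambda>s. s - a" 1 a "\<lambda>s. G (a + s)" D] by (simp add: o_def)
    next
      assume "(G has_vector_derivative D) (at a)"
      moreover have "((\<lambda>s. a + s) has_vector_derivative 1) (at 0)"
        by (auto intro!: derivative_eq_intros)
      ultimately show "((\<lambda>s. G (a + s)) has_vector_derivative D) (at 0)"
        using vector_diff_chain_at[of "\<lambda>s. a + s" 1 0 G D] by (simp add: o_def)
    qed
    then show ?thesis by (simp add: vector_derivative_def)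
  qed
  have "vector [u, t] + s *\<^sub>R axis 1 1 = (vector [u + s, t] :: real^2)"
    "vector [u, t] + s *\<^sub>R axis 2 1 = (vector [u, t + s] :: real^2)" for s
    by (simp_all add: vec_eq_iff forall_2 axis_def)
  then show ?first ?second
    by (simp_all add: partial_def shift[of "\<lambda>s. F (vector [s, t])"]
        shift[of "\<lambda>s. F (vector [u, s])"])
qed

text \<open>The hypothesis speaks of vector derivatives of the space curve, the conclusion of \<open>deriv\<close> of
  its components. The two agree only on \<open>I\<close>, so passing to second derivatives uses that \<open>I\<close> is a
  neighbourhood of \<open>u\<close>.\<close>

lemma C2_curve_on_generating_curveD:
  assumes "open I" "C2_curve_on I (generating_curve x y)" "u \<in> I"
  shows "(x has_real_derivative deriv x u) (at u)"
    "(y has_real_derivative deriv y u) (at u)"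
    "(deriv x has_real_derivative deriv (deriv x) u) (at u)"
    "(deriv y has_real_derivative deriv (deriv y) u) (at u)"
proof -
  let ?\<alpha> = "generating_curve x y" and ?\<alpha>' = "\<lambda>s. vector_derivative (generating_curve x y) (at s)"
  obtain A where A: "\<And>s. s \<in> I \<Longrightarrow> (?\<alpha> has_vector_derivative A s) (at s)"
    using assms(2) unfolding C2_curve_on_def C1_differentiable_on_def by blast
  obtain B where B: "\<And>s. s \<in> I \<Longrightarrow> (?\<alpha>' has_vector_derivative B s) (at s)"
    using assms(2) unfolding C2_curve_on_def C1_differentiable_on_def by blast
  have first: "(x has_real_derivative ?\<alpha>' s $ 1) (at s)"
    "(y has_real_derivative ?\<alpha>' s $ 2) (at s)" if "s \<in> I" for s
    using has_vector_derivative_nth[OF A[OF that], of 1]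
      has_vector_derivative_nth[OF A[OF that], of 2]
      vector_derivative_at[OF A[OF that]]
    by (simp_all add: generating_curve_def)
  have eq: "?\<alpha>' s $ 1 = deriv x s" "?\<alpha>' s $ 2 = deriv y s" if "s \<in> I" for s
    using first[OF that] by (simp_all add: DERIV_imp_deriv)
  show "(x has_real_derivative deriv x u) (at u)" "(y has_real_derivative deriv y u) (at u)"
    using first[OF assms(3)] eq[OF assms(3)] by simp_all
  have "(deriv x has_real_derivative B u $ 1) (at u)"
    using has_vector_derivative_nth[OF B[OF assms(3)], of 1]
    by (rule has_field_derivative_transform_within_open[OF _ assms(1,3)]) (simp add: eq)
  then show "(deriv x has_real_derivative deriv (deriv x) u) (at u)"
    by (simp add: DERIV_imp_deriv)
  have "(deriv y has_real_derivative B u $ 2) (at u)"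
    using has_vector_derivative_nth[OF B[OF assms(3)], of 2]
    by (rule has_field_derivative_transform_within_open[OF _ assms(1,3)]) (simp add: eq)
  then show "(deriv y has_real_derivative deriv (deriv y) u) (at u)"
    by (simp add: DERIV_imp_deriv)
qed

section \<open>Partial derivatives of the helicoidal surface\<close>

lemma helicoidal_ni_eq_boost:
  "helicoidal_ni c \<phi> x y (vector [u, t]) = boost (t * \<phi>) (vector [x u, y u, c * t])"
  by (simp add: helicoidal_ni_def boost_def)

lemma has_vector_derivative_boost_fixed_angle:
  assumes "(f has_real_derivative f') (at s)" "(g has_real_derivative g') (at s)"
  shows "((\<lambda>s. boost \<theta> (vector [f s, g s, d])) has_vector_derivative
           boost \<theta> (vector [f', g', 0])) (at s)"
  unfolding boost_def using assms
  by (auto intro!: has_vector_derivative_vector3 derivative_eq_intros)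

text \<open>Since \<open>cosh\<close> and \<open>sinh\<close> are each other's derivative, differentiating in the angle exchanges
  the first two components inside the boost. The affine third component covers both the surface
  (\<open>d = 0\<close>, \<open>e = c\<close>) and its tangent vector in the direction of \<open>t\<close> (\<open>d = c\<close>, \<open>e = 0\<close>).\<close>

lemma has_vector_derivative_boost_angle:
  "((\<lambda>s. boost (s * \<phi>) (vector [a, b, d + e * s])) has_vector_derivative
     boost (t * \<phi>) (vector [\<phi> * b, \<phi> * a, e])) (at t)"
  unfolding boost_def
  by (auto intro!: has_vector_derivative_vector3 derivative_eq_intros simp: algebra_simps)

lemma partial_2_helicoidal_ni:
  "partial 2 (helicoidal_ni c \<phi> x y) (vector [u, t])
     = boost (t * \<phi>) (vector [\<phi> * y u, \<phi> * x u, c])"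
  using has_vector_derivative_boost_angle[of \<phi> "x u" "y u" 0 c t]
  by (simp add: partial_eq helicoidal_ni_eq_boost vector_derivative_at)

lemma partial_22_helicoidal_ni:
  "partial 2 (partial 2 (helicoidal_ni c \<phi> x y)) (vector [u, t])
     = boost (t * \<phi>) (vector [\<phi>\<^sup>2 * x u, \<phi>\<^sup>2 * y u, 0])"
  using has_vector_derivative_boost_angle[of \<phi> "\<phi> * y u" "\<phi> * x u" c 0 t]
  by (simp add: partial_eq(2)[of "partial 2 _"] partial_2_helicoidal_ni vector_derivative_at
      power2_eq_square mult.assoc)

lemma partial_1_helicoidal_ni:
  assumes "(x has_real_derivative x') (at u)" "(y has_real_derivative y') (at u)"
  shows "partial 1 (helicoidal_ni c \<phi> x y) (vector [u, t]) = boost (t * \<phi>) (vector [x', y', 0])"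
  using has_vector_derivative_boost_fixed_angle[OF assms]
  by (simp add: partial_eq helicoidal_ni_eq_boost vector_derivative_at)

lemma partial_12_helicoidal_ni:
  assumes "(x has_real_derivative x') (at u)" "(y has_real_derivative y') (at u)"
  shows "partial 1 (partial 2 (helicoidal_ni c \<phi> x y)) (vector [u, t])
           = boost (t * \<phi>) (vector [\<phi> * y', \<phi> * x', 0])"
  using has_vector_derivative_boost_fixed_angle[OF DERIV_cmult[OF assms(2)] DERIV_cmult[OF assms(1)]]
  by (simp add: partial_eq(1)[of "partial 2 _"] partial_2_helicoidal_ni vector_derivative_at)

lemma partial_11_helicoidal_ni:
  assumes "open I" "C2_curve_on I (generating_curve x y)" "u \<in> I"
  shows "partial 1 (partial 1 (helicoidal_ni c \<phi> x y)) (vector [u, t])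
           = boost (t * \<phi>) (vector [deriv (deriv x) u, deriv (deriv y) u, 0])"
proof -
  note der = C2_curve_on_generating_curveD[OF assms(1,2)]
  have "((\<lambda>s. partial 1 (helicoidal_ni c \<phi> x y) (vector [s, t])) has_vector_derivative
      boost (t * \<phi>) (vector [deriv (deriv x) u, deriv (deriv y) u, 0])) (at u)"
  proof (rule has_vector_derivative_transform_within_open)
    show "((\<lambda>s. boost (t * \<phi>) (vector [deriv x s, deriv y s, 0])) has_vector_derivative
        boost (t * \<phi>) (vector [deriv (deriv x) u, deriv (deriv y) u, 0])) (at u)"
      using der(3,4)[OF assms(3)] by (rule has_vector_derivative_boost_fixed_angle)
    show "boost (t * \<phi>) (vector [deriv x s, deriv y s, 0])
        = partial 1 (helicoidal_ni c \<phi> x y) (vector [s, t])" if "s \<in> I" for s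
      by (rule partial_1_helicoidal_ni[OF der(1,2)[OF that], symmetric])
  qed (use assms(1,3) in simp_all)
  then show ?thesis
    by (simp add: partial_eq(1)[of "partial 1 _"] vector_derivative_at)
qed

section \<open>The curvatures\<close>

theorem proposition6p1:
  fixes c \<phi> :: real and x y :: "real \<Rightarrow> real" and I :: "real set"
  assumes "open I" and "is_interval I"
    and "C2_curve_on I (generating_curve x y)"
    and "admissible_on {p. p$1 \<in> I} (helicoidal_ni c \<phi> x y)"
  shows "\<forall>u\<in>I. \<forall>t::real.
    (let x0 = x u; x1 = deriv x u; x2 = deriv (deriv x) u;
         y0 = y u; y1 = deriv y u; y2 = deriv (deriv y) u
     in gaussian_curvature (helicoidal_ni c \<phi> x y) (vector [u, t])
          = c\<^sup>2 / \<phi>\<^sup>2 * (((x1\<^sup>2 - y1\<^sup>2)\<^sup>2 - (x0 * y1 - x1 * y0) * (x2 * y1 - x1 * y2))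
                        / (x0 * x1 - y0 * y1) ^ 4)
      \<and> mean_curvature (helicoidal_ni c \<phi> x y) (vector [u, t])
          = c / \<phi> * (((x0\<^sup>2 - y0\<^sup>2) * (x2 * y1 - x1 * y2) + (x1\<^sup>2 - y1\<^sup>2) * (x0 * y1 - x1 * y0))
                      / (2 * (x0 * x1 - y0 * y1) ^ 3)))"
proof (intro ballI allI)
  fix u t :: real
  assume u: "u \<in> I"
  define x0 x1 x2 where "x0 = x u" and "x1 = deriv x u" and "x2 = deriv (deriv x) u"
  define y0 y1 y2 where "y0 = y u" and "y1 = deriv y u" and "y2 = deriv (deriv y) u"
  note val = x0_def x1_def x2_def y0_def y1_def y2_def
  define D W a Q where "D = x0 * x1 - y0 * y1" and "W = x0 * y1 - x1 * y0"
    and "a = x1\<^sup>2 - y1\<^sup>2" and "Q = x2 * y1 - x1 * y2"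
  let ?S = "helicoidal_ni c \<phi> x y" and ?p = "vector [u, t] :: real^2"
  note der = C2_curve_on_generating_curveD[OF assms(1,3) u, folded val]

  have S1: "partial 1 ?S ?p = boost (t * \<phi>) (vector [x1, y1, 0])"
    by (rule partial_1_helicoidal_ni[OF der(1,2)])
  have S2: "partial 2 ?S ?p = boost (t * \<phi>) (vector [\<phi> * y0, \<phi> * x0, c])"
    by (simp add: partial_2_helicoidal_ni val)
  have S11: "partial 1 (partial 1 ?S) ?p = boost (t * \<phi>) (vector [x2, y2, 0])"
    by (simp add: partial_11_helicoidal_ni[OF assms(1,3) u] val)
  have S12: "partial 1 (partial 2 ?S) ?p = boost (t * \<phi>) (vector [\<phi> * y1, \<phi> * x1, 0])"
    by (rule partial_12_helicoidal_ni[OF der(1,2)])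
  have S22: "partial 2 (partial 2 ?S) ?p = boost (t * \<phi>) (vector [\<phi>\<^sup>2 * x0, \<phi>\<^sup>2 * y0, 0])"
    by (simp add: partial_22_helicoidal_ni val)

  have X12: "tangent_minor ?S 1 2 ?p = \<phi> * D"
    unfolding tangent_minor_def S1 S2 minor_boost by (simp add: D_def algebra_simps)
  have "tangent_minor ?S 1 2 ?p \<noteq> 0"
    using assms(4) u by (simp add: admissible_on_def)
  then have nz: "\<phi> \<noteq> 0" "D \<noteq> 0" by (simp_all add: X12)

  have normal: "normal_h ?S ?p = boost (t * \<phi>) (vector [c * y1 / (\<phi> * D), c * x1 / (\<phi> * D), 1])"
    unfolding normal_h_def X12
    by (simp add: tangent_minor_def S1 S2 vec_eq_iff forall_3 add_divide_distrib algebra_simps)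

  have g11: "first_form ?S 1 1 ?p = a"
    and g12: "first_form ?S 1 2 ?p = - \<phi> * W"
    and g22: "first_form ?S 2 2 ?p = - \<phi>\<^sup>2 * (x0\<^sup>2 - y0\<^sup>2)"
    unfolding first_form_def S1 S2 inner_pz_boost
    by (simp_all add: inner_pz_def a_def W_def algebra_simps power2_eq_square)
  have h11: "second_form ?S 1 1 ?p = c * Q / (\<phi> * D)"
    and h12: "second_form ?S 1 2 ?p = - c * a / D"
    and h22: "second_form ?S 2 2 ?p = c * \<phi> * W / D"
    unfolding second_form_def S11 S12 S22 normal inner_1_boost using nz
    by (simp_all add: inner_1_def Q_def a_def W_def field_simps power2_eq_square)
  have "a * (x0\<^sup>2 - y0\<^sup>2) + W\<^sup>2 = D\<^sup>2"
    by (simp add: a_def W_def D_def algebra_simps power2_eq_square)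
  then have "- \<phi>\<^sup>2 * (a * (x0\<^sup>2 - y0\<^sup>2) + W\<^sup>2) = - \<phi>\<^sup>2 * D\<^sup>2" by simp
  then have det: "first_form ?S 1 1 ?p * first_form ?S 2 2 ?p - (first_form ?S 1 2 ?p)\<^sup>2
      = - \<phi>\<^sup>2 * D\<^sup>2"
    unfolding g11 g12 g22 by (simp add: algebra_simps power2_eq_square)

  have "gaussian_curvature ?S ?p = c\<^sup>2 / \<phi>\<^sup>2 * ((a\<^sup>2 - W * Q) / D ^ 4)"
    unfolding gaussian_curvature_def det h11 h12 h22 using nz
    by (simp add: field_simps power2_eq_square power4_eq_xxxx)
  moreover have "mean_curvature ?S ?p = c / \<phi> * (((x0\<^sup>2 - y0\<^sup>2) * Q + a * W) / (2 * D ^ 3))"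
    unfolding mean_curvature_def det unfolding g11 g12 g22 h11 h12 h22 using nz
    by (simp add: field_simps power2_eq_square power3_eq_cube)
  ultimately show "let x0 = x u; x1 = deriv x u; x2 = deriv (deriv x) u;
         y0 = y u; y1 = deriv y u; y2 = deriv (deriv y) u
     in gaussian_curvature (helicoidal_ni c \<phi> x y) (vector [u, t])
          = c\<^sup>2 / \<phi>\<^sup>2 * (((x1\<^sup>2 - y1\<^sup>2)\<^sup>2 - (x0 * y1 - x1 * y0) * (x2 * y1 - x1 * y2))
                        / (x0 * x1 - y0 * y1) ^ 4)
      \<and> mean_curvature (helicoidal_ni c \<phi> x y) (vector [u, t])
          = c / \<phi> * (((x0\<^sup>2 - y0\<^sup>2) * (x2 * y1 - x1 * y2) + (x1\<^sup>2 - y1\<^sup>2) * (x0 * y1 - x1 * y0))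
                      / (2 * (x0 * x1 - y0 * y1) ^ 3))"
    unfolding Let_def D_def W_def a_def Q_def val by blast
qed

end
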